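(* Let $G=(V,E)$ be a finite or locally finite weighted graph with edge weights $w_{xy}$ and measure $\mu$, and suppose $D_\mu=\sup_{x\in V}\deg(x)/\mu(x)<+\infty$. If $u:V\to\mathbb{R}$ is a positive function, then $$\frac{\Gamma(\sqrt{u})(x)}{u(x)}-\frac{\Delta u(x)}{2u(x)}\leq D_\mu,\quad\forall x\in V.$$ In particular, if $u:V\times\mathbb{R}\to\mathbb{R}$, $(x,t)\mapsto u(x,t)$, is a positive solution to the heat equation $(\Delta-\partial_t)u=0$, then $$\frac{\Gamma(\sqrt{u})(x,t)}{u(x,t)}-\frac{\partial_t\sqrt{u}(x,t)}{\sqrt{u}(x,t)}\leq D_\mu,\quad\forall x\in V,\ t\in\mathbb{R}.$$
   Context: $G=(V,E)$ is a finite or locally finite graph (every vertex has finitely many neighbours) with vertex set $V$ and edge set $E$. We write $y\sim x$ if $y$ is adjacent to $x$, i.e. $xy\in E$. Each edge $xy\in E$ has a weight $w_{xy}>0$ (symmetry $w_{xy}=w_{yx}$ is not assumed). The degree of $x\in V$ is $\deg(x)=\sum_{y\sim x}w_{xy}$. $\mu$ is a measure on $V$ with $0<\mu(x)<\infty$ for each $x\in V$. For $f,g:V\to\mathbb{R}$, the $\mu$-Laplacian and the gradient form are $$\Delta f(x)=\frac{1}{\mu(x)}\sum_{y\sim x}w_{xy}(f(y)-f(x)),\qquad 2\Gamma(f,g)(x)=\frac{1}{\mu(x)}\sum_{y\sim x}w_{xy}(f(y)-f(x))(g(y)-g(x)),$$ and $\Gamma(f)=\Gamma(f,f)$. For functions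 $u(x,t)$ depending also on time, $\Delta$ and $\Gamma$ act on the variable $x$ for fixed $t$, and $u$ is differentiable in $t$. *)

theory Defs
  imports "HOL-Analysis.Analysis"
begin

text \<open>
  Edges are unordered pairs, so adjacency is symmetric, while the weight \<open>w x y\<close>
  may differ from \<open>w y x\<close>. Loops (\<open>{x, x} \<in> E\<close>) are neither required nor excluded. A finite
  graph is in particular locally finite.
\<close>

definition neighbours :: "'a set set \<Rightarrow> 'a \<Rightarrow> 'a set" where
  "neighbours E x = {y. {x, y} \<in> E}"

locale weighted_graph =
  fixes V :: "'a set"
    and E :: "'a set set"
    and w :: "'a \<Rightarrow> 'a \<Rightarrow> real"
    and \<mu> :: "'a \<Rightarrow> real"
  assumes edges: "e \<in> E \<Longrightarrow> \<exists>x\<in>V. \<exists>y\<in>V. e = {x, y}"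
    and locally_finite: "x \<in> V \<Longrightarrow> finite (neighbours E x)"
    and weight_pos: "{x, y} \<in> E \<Longrightarrow> 0 < w x y"
    and measure_pos: "x \<in> V \<Longrightarrow> 0 < \<mu> x"

definition deg :: "'a set set \<Rightarrow> ('a \<Rightarrow> 'a \<Rightarrow> real) \<Rightarrow> 'a \<Rightarrow> real" where
  "deg E w x = (\<Sum>y\<in>neighbours E x. w x y)"

definition D_mu ::
  "'a set \<Rightarrow> 'a set set \<Rightarrow> ('a \<Rightarrow> 'a \<Rightarrow> real) \<Rightarrow> ('a \<Rightarrow> real) \<Rightarrow> ereal" where
  "D_mu V E w \<mu> = (SUP x\<in>V. ereal (deg E w x / \<mu> x))"

definition laplacian ::
  "'a set set \<Rightarrow> ('a \<Rightarrow> 'a \<Rightarrow> real) \<Rightarrow> ('a \<Rightarrow> real) \<Rightarrow> ('a \<Rightarrow> real) \<Rightarrow> 'a \<Rightarrow> real" where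
  "laplacian E w \<mu> f x = (1 / \<mu> x) * (\<Sum>y\<in>neighbours E x. w x y * (f y - f x))"

definition gradient_form ::
  "'a set set \<Rightarrow> ('a \<Rightarrow> 'a \<Rightarrow> real) \<Rightarrow> ('a \<Rightarrow> real) \<Rightarrow> ('a \<Rightarrow> real) \<Rightarrow> ('a \<Rightarrow> real) \<Rightarrow> 'a \<Rightarrow> real" where
  "gradient_form E w \<mu> f g x =
     (1 / 2) * ((1 / \<mu> x) * (\<Sum>y\<in>neighbours E x. w x y * (f y - f x) * (g y - g x)))"

abbreviation gradient_sq ::
  "'a set set \<Rightarrow> ('a \<Rightarrow> 'a \<Rightarrow> real) \<Rightarrow> ('a \<Rightarrow> real) \<Rightarrow> ('a \<Rightarrow> real) \<Rightarrow> 'a \<Rightarrow> real" where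
  "gradient_sq E w \<mu> f \<equiv> gradient_form E w \<mu> f f"

definition heat_solution ::
  "'a set \<Rightarrow> 'a set set \<Rightarrow> ('a \<Rightarrow> 'a \<Rightarrow> real) \<Rightarrow> ('a \<Rightarrow> real) \<Rightarrow> ('a \<Rightarrow> real \<Rightarrow> real) \<Rightarrow> bool" where
  "heat_solution V E w \<mu> u \<longleftrightarrow>
     (\<forall>x\<in>V. \<forall>t. (\<lambda>s. u x s) differentiable (at t) \<and>
        laplacian E w \<mu> (\<lambda>y. u y t) x - deriv (\<lambda>s. u x s) t = 0)"

end

theory Submission
  imports Defs
begin

text \<open>
  The quantity to be bounded is \<open>- \<Delta>\<surd>u / \<surd>u\<close>. Indeed the discrete product rule
  \<open>\<Delta>(f\<^sup>2) = 2 f \<Delta>f + 2 \<Gamma>(f)\<close>, applied to \<open>f = \<surd>u\<close> and divided by \<open>2 u\<close>, is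
  \<open>\<Gamma>(\<surd>u)/u - \<Delta>u/(2u) = - \<Delta>\<surd>u / \<surd>u\<close> (lemma \<open>laplacian_eq_sqrt\<close>). For a
  nonnegative function \<open>f\<close>, each difference \<open>f x - f y\<close> in \<open>- \<Delta>f x\<close> is at most \<open>f x\<close>, so
  \<open>- \<Delta>f x \<le> (deg x / \<mu> x) f x\<close> (lemma \<open>minus_laplacian_le\<close>). Together these give the
  bound \<open>deg x / \<mu> x\<close> at each single vertex; the supremum enters only in the last step.

  For a solution of the heat equation the chain rule gives
  \<open>\<partial>\<^sub>t\<surd>u / \<surd>u = \<partial>\<^sub>tu / (2u) = \<Delta>u / (2u)\<close>, so the second inequality is the first one,
  applied at each fixed time.
\<close>

lemma (in weighted_graph) neighbours_subset: "neighbours E x \<subseteq> V"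
proof
  fix y assume "y \<in> neighbours E x"
  then have "{x, y} \<in> E" by (simp add: neighbours_def)
  from edges[OF this] show "y \<in> V" by (auto simp: doubleton_eq_iff)
qed

text \<open>
  Summing \<open>b\<^sup>2 - a\<^sup>2 = 2 a (b - a) + (b - a)\<^sup>2\<close> over the neighbours, with \<open>a\<close> and \<open>b\<close> the
  values of \<open>\<surd>u\<close> at \<open>x\<close> and at a neighbour.
\<close>
lemma laplacian_eq_sqrt:
  assumes "0 \<le> u x" and "\<And>y. y \<in> neighbours E x \<Longrightarrow> 0 \<le> u y"
  shows "laplacian E w \<mu> u x =
    2 * sqrt (u x) * laplacian E w \<mu> (\<lambda>y. sqrt (u y)) x
      + 2 * gradient_sq E w \<mu> (\<lambda>y. sqrt (u y)) x"
proof -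
  let ?d = "\<lambda>y. sqrt (u y) - sqrt (u x)"
  have "w x y * (u y - u x) = 2 * sqrt (u x) * (w x y * ?d y) + w x y * ?d y * ?d y"
    if "y \<in> neighbours E x" for y
  proof -
    have "u y - u x = 2 * sqrt (u x) * ?d y + ?d y * ?d y"
      using assms(1) assms(2)[OF that] by (simp add: algebra_simps)
    then show ?thesis by (simp only: distrib_left mult_ac)
  qed
  then have "(\<Sum>y\<in>neighbours E x. w x y * (u y - u x)) =
      2 * sqrt (u x) * (\<Sum>y\<in>neighbours E x. w x y * ?d y)
        + (\<Sum>y\<in>neighbours E x. w x y * ?d y * ?d y)"
    by (simp add: sum.distrib sum_distrib_left)
  then show ?thesis
    by (simp add: laplacian_def gradient_form_def distrib_left add_divide_distrib)
qed

lemma minus_laplacian_le: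
  assumes "0 < \<mu> x"
    and "\<And>y. y \<in> neighbours E x \<Longrightarrow> 0 \<le> w x y"
    and "\<And>y. y \<in> neighbours E x \<Longrightarrow> 0 \<le> f y"
  shows "- laplacian E w \<mu> f x \<le> deg E w x / \<mu> x * f x"
proof -
  have "- (\<Sum>y\<in>neighbours E x. w x y * (f y - f x)) \<le> (\<Sum>y\<in>neighbours E x. w x y * f x)"
    unfolding sum_negf[symmetric]
    by (rule sum_mono) (simp add: algebra_simps assms(2,3))
  also have "\<dots> = deg E w x * f x"
    by (simp add: deg_def sum_distrib_right)
  finally show ?thesis
    using divide_right_mono[of _ "deg E w x * f x" "\<mu> x"] assms(1)
    by (fastforce simp: laplacian_def)
qed

lemma (in weighted_graph) gradient_sqrt_estimate:
  assumes pos: "\<And>y. y \<in> V \<Longrightarrow> 0 < u y" and x: "x \<in> V"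
  shows "gradient_sq E w \<mu> (\<lambda>y. sqrt (u y)) x / u x - laplacian E w \<mu> u x / (2 * u x)
    \<le> deg E w x / \<mu> x"
proof -
  let ?v = "\<lambda>y. sqrt (u y)"
  have nonneg: "0 \<le> u y" if "y \<in> neighbours E x" for y
    using pos neighbours_subset that by (auto intro: less_imp_le)
  have ux: "0 < u x" using pos x .
  have "laplacian E w \<mu> u x =
      2 * ?v x * laplacian E w \<mu> ?v x + 2 * gradient_sq E w \<mu> ?v x"
    using ux nonneg by (intro laplacian_eq_sqrt) auto
  then have "gradient_sq E w \<mu> ?v x / u x - laplacian E w \<mu> u x / (2 * u x)
      = - laplacian E w \<mu> ?v x * ?v x / u x"
    using ux by (simp add: field_simps)
  also have "\<dots> \<le> (deg E w x / \<mu> x * ?v x) * ?v x / u x"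
  proof -
    have "- laplacian E w \<mu> ?v x \<le> deg E w x / \<mu> x * ?v x"
      using measure_pos[OF x] nonneg weight_pos
      by (intro minus_laplacian_le) (auto simp: neighbours_def intro: less_imp_le)
    then show ?thesis
      using ux by (intro divide_right_mono mult_right_mono) auto
  qed
  also have "\<dots> = deg E w x / \<mu> x"
    using ux by (simp add: mult.assoc)
  finally show ?thesis .
qed

lemma deriv_sqrt_div_sqrt:
  fixes g :: "real \<Rightarrow> real"
  assumes "g differentiable (at t)" and "0 < g t"
  shows "deriv (\<lambda>s. sqrt (g s)) t / sqrt (g t) = deriv g t / (2 * g t)"
proof -
  have "(g has_real_derivative deriv g t) (at t)"
    using assms(1) by (simp add: DERIV_deriv_iff_real_differentiable)
  then have "((\<lambda>s. sqrt (g s)) has_real_derivative inverse (sqrt (g t)) / 2 * deriv g t) (at t)"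
    using assms(2) by (intro DERIV_chain2[where f = sqrt] DERIV_real_sqrt)
  then have "deriv (\<lambda>s. sqrt (g s)) t / sqrt (g t)
      = inverse (sqrt (g t)) / 2 * deriv g t / sqrt (g t)"
    by (simp only: DERIV_imp_deriv)
  also have "\<dots> = deriv g t / (2 * (sqrt (g t) * sqrt (g t)))"
    by (simp only: inverse_eq_divide times_divide_eq_left times_divide_eq_right
        divide_divide_eq_left mult_1_left mult_ac)
  also have "\<dots> = deriv g t / (2 * g t)"
    using assms(2) by simp
  finally show ?thesis .
qed

theorem theorem1:
  fixes V :: "'a set" and E :: "'a set set"
    and w :: "'a \<Rightarrow> 'a \<Rightarrow> real" and \<mu> :: "'a \<Rightarrow> real"
  assumes graph: "weighted_graph V E w \<mu>"
    and D_finite: "D_mu V E w \<mu> < \<infinity>"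
  shows "(\<forall>u :: 'a \<Rightarrow> real. (\<forall>x\<in>V. 0 < u x) \<longrightarrow>
            (\<forall>x\<in>V. ereal (gradient_sq E w \<mu> (\<lambda>y. sqrt (u y)) x / u x
                - laplacian E w \<mu> u x / (2 * u x)) \<le> D_mu V E w \<mu>))
       \<and> (\<forall>u :: 'a \<Rightarrow> real \<Rightarrow> real. (\<forall>x\<in>V. \<forall>t. 0 < u x t) \<longrightarrow> heat_solution V E w \<mu> u \<longrightarrow>
            (\<forall>x\<in>V. \<forall>t. ereal (gradient_sq E w \<mu> (\<lambda>y. sqrt (u y t)) x / u x t
                - deriv (\<lambda>s. sqrt (u x s)) t / sqrt (u x t)) \<le> D_mu V E w \<mu>))"
proof -
  interpret weighted_graph V E w \<mu> by (rule graph)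
  have le_D: "ereal a \<le> D_mu V E w \<mu>" if "a \<le> deg E w x / \<mu> x" and "x \<in> V" for a x
    unfolding D_mu_def using that by (intro SUP_upper2[of x]) auto
  show ?thesis
  proof (intro conjI allI impI ballI)
    fix u :: "'a \<Rightarrow> real" and x
    assume "\<forall>x\<in>V. 0 < u x" and "x \<in> V"
    then show "ereal (gradient_sq E w \<mu> (\<lambda>y. sqrt (u y)) x / u x
        - laplacian E w \<mu> u x / (2 * u x)) \<le> D_mu V E w \<mu>"
      by (intro le_D[where x = x] gradient_sqrt_estimate) auto
  next
    fix u :: "'a \<Rightarrow> real \<Rightarrow> real" and x t
    assume pos: "\<forall>x\<in>V. \<forall>t. 0 < u x t" and heat: "heat_solution V E w \<mu> u" and x: "x \<in> V"
    have "deriv (\<lambda>s. sqrt (u x s)) t / sqrt (u x t)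
        = laplacian E w \<mu> (\<lambda>y. u y t) x / (2 * u x t)"
      using heat x pos deriv_sqrt_div_sqrt[of "u x" t] by (simp add: heat_solution_def)
    moreover have "gradient_sq E w \<mu> (\<lambda>y. sqrt (u y t)) x / u x t
        - laplacian E w \<mu> (\<lambda>y. u y t) x / (2 * u x t) \<le> deg E w x / \<mu> x"
      using pos x by (intro gradient_sqrt_estimate) auto
    ultimately show "ereal (gradient_sq E w \<mu> (\<lambda>y. sqrt (u y t)) x / u x t
        - deriv (\<lambda>s. sqrt (u x s)) t / sqrt (u x t)) \<le> D_mu V E w \<mu>"
      using x by (intro le_D) auto
  qed
qed

end
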